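(* Let $0\leq \beta <1$. The Booth lemniscate starlikeness radius of order $0$ for the class $\mathcal{S}^*(\beta)$ of starlike functions of order $\beta$ is $$R_{\mathcal{BS}(0)}(\mathcal{S}^*(\beta))=\frac{1}{3-2\beta}.$$
   Context: $\mathbb{D}=\{z\in\mathbb{C}:|z|<1\}$. $\mathcal{A}$ is the class of analytic functions $f$ on $\mathbb{D}$ with $f(0)=0$, $f'(0)=1$. The expression $zf'(z)/f(z)$ takes the value $1$ at $z=0$; in conditions on it, it is understood to be analytic. For $0\le\alpha<1$, $G_\alpha(z)=1+\dfrac{z}{1-\alpha z^2}$ on $\mathbb{D}$ (so $G_0(z)=1+z$). For a class $\mathcal{M}\subseteq\mathcal{A}$ and $f\in\mathcal{M}$ let $$R_f=\sup\left\{r\in(0,1): \frac{zf'(z)}{f(z)}\in G_\alpha(\mathbb{D})\text{ for all }|z|\le r\right\},\qquad R_{\mathcal{BS}(\alpha)}(\mathcal{M})=\inf\{R_f: f\in\mathcal{M}\}.$$ The number $R_{\mathcal{BS}(\alpha)}(\mathcal{M})$ is called the Booth lemniscate starlikeness radius of order $\alpha$ of $\mathcal{M}$. For $0\le\beta<1$, $\mathcal{S}^*(\beta)$ is the class of starlike functions of order $\beta$: the $f\in\mathcal{A}$ with $\operatorname{Re}\left(zf'(z)/f(z)\right)>\beta$ for all $z\in\mathbb{D}$. *)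

theory Defs
  imports "HOL-Complex_Analysis.Complex_Analysis"
begin

abbreviation unit_disc :: "complex set" ("\<D>") where
  "\<D> \<equiv> ball 0 1"

definition normalized_analytic :: "(complex \<Rightarrow> complex) set" ("\<A>") where
  "\<A> = {f. f holomorphic_on \<D> \<and> f 0 = 0 \<and> deriv f 0 = 1}"

text \<open>The quotient \<open>z f'(z) / f(z)\<close> with its removable singularity at \<open>0\<close> filled in. At a zero of
  \<open>f\<close> other than \<open>0\<close> the quotient has a pole and the HOL value \<open>0\<close> is meaningless; the conditions
  on the quotient below therefore also ask that it be analytic, which excludes such zeros.\<close>

definition starlike_quotient :: "(complex \<Rightarrow> complex) \<Rightarrow> complex \<Rightarrow> complex" where
  "starlike_quotient f z = (if z = 0 then 1 else z * deriv f z / f z)"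

definition booth_fun :: "real \<Rightarrow> complex \<Rightarrow> complex" where
  "booth_fun \<alpha> z = 1 + z / (1 - complex_of_real \<alpha> * z\<^sup>2)"

text \<open>For \<open>f \<in> \<A>\<close> and \<open>0 \<le> \<alpha> < 1\<close> the set below is nonempty, since the quotient is analytic near
  \<open>0\<close> with value \<open>1\<close>, and bounded by \<open>1\<close>; the supremum in the reals is thus the genuine one.
  Likewise for the infimum over a nonempty class of functions in \<open>\<A>\<close>.\<close>

definition booth_radius_fun :: "real \<Rightarrow> (complex \<Rightarrow> complex) \<Rightarrow> real" where
  "booth_radius_fun \<alpha> f = Sup {r. 0 < r \<and> r < 1 \<and>
     starlike_quotient f analytic_on cball 0 r \<and>
     (\<forall>z. norm z \<le> r \<longrightarrow> starlike_quotient f z \<in> booth_fun \<alpha> ` \<D>)}"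

definition booth_radius :: "real \<Rightarrow> (complex \<Rightarrow> complex) set \<Rightarrow> real" where
  "booth_radius \<alpha> M = (INF f\<in>M. booth_radius_fun \<alpha> f)"

definition starlike_of_order :: "real \<Rightarrow> (complex \<Rightarrow> complex) set" ("\<S>\<^sup>*") where
  "\<S>\<^sup>* \<beta> = {f \<in> \<A>. starlike_quotient f analytic_on \<D> \<and>
     (\<forall>z\<in>\<D>. Re (starlike_quotient f z) > \<beta>)}"

end

theory Submission
  imports Defs
begin

text \<open>Set \<open>p = starlike_quotient f\<close>. The condition \<open>Re p > \<beta>\<close> with \<open>p 0 = 1\<close> makes
  \<open>w = (p - 1) / (p + 1 - 2\<beta>)\<close> a Schwarz function, so \<open>p - 1 = 2(1 - \<beta>) w / (1 - w)\<close> has modulus at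
  most \<open>2(1 - \<beta>)r / (1 - r)\<close> on \<open>|z| \<le> r\<close>, which is below \<open>1\<close> exactly for \<open>r < 1 / (3 - 2\<beta>)\<close>. For
  the generalized Koebe function \<open>z (1 - z) powr (-2(1 - \<beta>))\<close> one has \<open>w z = z\<close>, and the bound is
  attained on the positive real axis.\<close>

lemma booth_fun_0_image: "booth_fun 0 ` \<D> = ball 1 1"
proof -
  have "booth_fun 0 = (\<lambda>z. 1 + z)" by (auto simp: booth_fun_def)
  then show ?thesis by (simp add: image_add_ball)
qed

lemma Re_gt_imp_norm_bound:
  fixes p :: "complex \<Rightarrow> complex"
  assumes holo: "p holomorphic_on \<D>" and p0: "p 0 = 1" and "\<beta> < 1"
    and Re: "\<And>z. z \<in> \<D> \<Longrightarrow> Re (p z) > \<beta>" and z: "norm z < 1"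
  shows "norm (p z - 1) \<le> 2 * (1 - \<beta>) * norm z / (1 - norm z)"
proof -
  define w where "w = (\<lambda>z. (p z - 1) / (p z + 1 - 2 * \<beta>))"
  have nz: "p u + 1 - 2 * \<beta> \<noteq> 0" if "u \<in> \<D>" for u
  proof
    assume "p u + 1 - 2 * \<beta> = 0"
    then have "Re (p u + 1 - 2 * \<beta>) = 0" by simp
    with Re[OF that] \<open>\<beta> < 1\<close> show False by simp
  qed
  have w_lt: "norm (w u) < 1" if "norm u < 1" for u
  proof -
    have u: "u \<in> \<D>" using that by simp
    \<comment> \<open>Twice this product is the difference of the squared moduli of
      \<open>p u + 1 - 2 * \<beta>\<close> and \<open>p u - 1\<close>; the imaginary parts
      cancel.\<close>
    have "(2 - 2 * \<beta>) * (Re (p u) - \<beta>) > 0" using Re[OF u] \<open>\<beta> < 1\<close> by simp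
    then have "(norm (p u - 1))\<^sup>2 < (norm (p u + 1 - 2 * \<beta>))\<^sup>2"
      unfolding cmod_power2 by (simp add: power2_eq_square algebra_simps)
    then have "norm (p u - 1) < norm (p u + 1 - 2 * \<beta>)"
      using power_less_imp_less_base norm_ge_zero by blast
    then show ?thesis using nz[OF u] by (simp add: w_def norm_divide)
  qed
  have "w holomorphic_on \<D>"
    unfolding w_def by (intro holomorphic_intros holo nz)
  moreover have "w 0 = 0" by (simp add: w_def p0)
  ultimately have wz: "norm (w z) \<le> norm z"
    using Schwarz_Lemma(1) w_lt z by blast
  \<comment> \<open>The relation between \<open>w\<close> and \<open>p\<close> is kept in the form
    \<open>w z * (d + 2 * (1 - \<beta>)) = d\<close>. Taking norms and applying the triangle
    inequality then bounds \<open>norm d\<close> without solving for \<open>d\<close>.\<close>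
  define d where "d = p z - 1"
  have "p z + 1 - 2 * \<beta> = d + of_real (2 * (1 - \<beta>))" by (simp add: d_def algebra_simps)
  moreover have "w z * (p z + 1 - 2 * \<beta>) = d"
    using nz[of z] z by (simp add: w_def d_def)
  ultimately have "w z * (d + of_real (2 * (1 - \<beta>))) = d" by (simp only:)
  then have "norm d = norm (w z) * norm (d + of_real (2 * (1 - \<beta>)))"
    using norm_mult[of "w z" "d + of_real (2 * (1 - \<beta>))"] by (simp only:)
  also have "\<dots> \<le> norm z * (norm d + 2 * (1 - \<beta>))"
  proof (rule mult_mono[OF wz])
    have "norm (d + of_real (2 * (1 - \<beta>))) \<le> norm d + norm (complex_of_real (2 * (1 - \<beta>)))"
      by (rule norm_triangle_ineq)
    then show "norm (d + of_real (2 * (1 - \<beta>))) \<le> norm d + 2 * (1 - \<beta>)"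
      unfolding norm_of_real using \<open>\<beta> < 1\<close> by simp
  qed auto
  finally have "norm d * (1 - norm z) \<le> 2 * (1 - \<beta>) * norm z"
    by (simp add: algebra_simps)
  then show ?thesis using z by (simp add: d_def pos_le_divide_eq)
qed

text \<open>For \<open>t = norm z\<close>, the inequality
  \<open>2 * (1 - \<beta>) * t < 1 - t\<close> is the same as
  \<open>t < 1 / (3 - 2 * \<beta>)\<close>. Membership in the whole set under the supremum serves
  both to bound that supremum from below and to show the set nonempty.\<close>

lemma starlike_quotient_in_booth_image:
  assumes "\<beta> < 1" and f: "f \<in> \<S>\<^sup>* \<beta>" and r: "0 < r" "r < 1 / (3 - 2 * \<beta>)"
  shows "r \<in> {r. 0 < r \<and> r < 1 \<and> starlike_quotient f analytic_on cball 0 r \<and>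
     (\<forall>z. norm z \<le> r \<longrightarrow> starlike_quotient f z \<in> booth_fun 0 ` \<D>)}"
proof -
  have an: "starlike_quotient f analytic_on \<D>" and
    Re: "\<And>z. z \<in> \<D> \<Longrightarrow> Re (starlike_quotient f z) > \<beta>"
    using f by (auto simp: starlike_of_order_def)
  have "1 / (3 - 2 * \<beta>) < 1" using \<open>\<beta> < 1\<close> by simp
  with r have r1: "r < 1" by linarith
  have "starlike_quotient f z \<in> booth_fun 0 ` \<D>" if "norm z \<le> r" for z
  proof -
    have z: "norm z < 1 / (3 - 2 * \<beta>)" "norm z < 1" using that r r1 by auto
    have "norm (starlike_quotient f z - 1) \<le> 2 * (1 - \<beta>) * norm z / (1 - norm z)"
      using analytic_imp_holomorphic[OF an] Re \<open>\<beta> < 1\<close> z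
      by (intro Re_gt_imp_norm_bound) (simp_all add: starlike_quotient_def[of f 0])
    also have "\<dots> < 1"
      using z \<open>\<beta> < 1\<close> by (simp add: field_simps)
    finally show ?thesis
      by (simp add: booth_fun_0_image dist_norm norm_minus_commute)
  qed
  moreover have "starlike_quotient f analytic_on cball 0 r"
    using r1 by (intro analytic_on_subset[OF an]) auto
  ultimately show ?thesis using r r1 by blast
qed

lemma starlike_booth_radius_fun_ge:
  assumes "\<beta> < 1" and "f \<in> \<S>\<^sup>* \<beta>"
  shows "booth_radius_fun 0 f \<ge> 1 / (3 - 2 * \<beta>)"
\<comment> \<open>At the endpoint the estimate gives only distance at most 1 from 1, while the image
  disc is open, so the endpoint is approached from below.\<close>
proof (rule dense_le_bounded)
  show "0 < 1 / (3 - 2 * \<beta>)" using \<open>\<beta> < 1\<close> by simp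
  show "r \<le> booth_radius_fun 0 f" if "0 < r" "r < 1 / (3 - 2 * \<beta>)" for r
    unfolding booth_radius_fun_def
    using starlike_quotient_in_booth_image[OF assms that]
    by (rule cSup_upper) (auto intro!: bdd_aboveI[where M = 1])
qed

text \<open>The case \<beta> = 0 is the Koebe function z / (1 - z)^2. The power is spelled out with
  \<open>exp\<close> and \<open>Ln\<close>, which makes it visibly nonzero.\<close>

definition koebe_fun :: "real \<Rightarrow> complex \<Rightarrow> complex" where
  "koebe_fun \<beta> z = z * exp (- of_real (2 * (1 - \<beta>)) * Ln (1 - z))"

text \<open>\<open>1 - z\<close> has positive real part, hence stays off the branch cut of
  \<open>Ln\<close>.\<close>

lemma one_minus_notin_nonpos_Reals: "z \<in> \<D> \<Longrightarrow> 1 - z \<notin> \<real>\<^sub>\<le>\<^sub>0"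
  using complex_Re_le_cmod[of z] by (auto simp: complex_nonpos_Reals_iff)

lemma has_field_derivative_koebe_fun:
  assumes "z \<in> \<D>"
  shows "(koebe_fun \<beta> has_field_derivative
    exp (- of_real (2 * (1 - \<beta>)) * Ln (1 - z)) * (1 + of_real (2 * (1 - \<beta>)) * z / (1 - z))) (at z)"
proof -
  have "((\<lambda>z. z * exp (- c * Ln (1 - z))) has_field_derivative
      exp (- c * Ln (1 - z)) * (1 + c * z / (1 - z))) (at z)" for c :: complex
    by (rule derivative_eq_intros refl one_minus_notin_nonpos_Reals[OF assms])+
      (simp add: algebra_simps divide_inverse)
  from this[of "of_real (2 * (1 - \<beta>))"] show ?thesis
    unfolding koebe_fun_def .
qed

lemma starlike_quotient_koebe_fun:
  assumes "z \<in> \<D>"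
  shows "starlike_quotient (koebe_fun \<beta>) z = 1 + of_real (2 * (1 - \<beta>)) * z / (1 - z)"
  using DERIV_imp_deriv[OF has_field_derivative_koebe_fun[OF assms]]
  by (simp add: starlike_quotient_def koebe_fun_def)

text \<open>The real part of z / (1 - z) + 1/2 is (1 - |z|^2) / (2 |1 - z|^2).\<close>

lemma Re_div_one_minus_gt:
  assumes "norm z < 1"
  shows "Re (z / (1 - z)) > - 1 / 2"
proof -
  have "(Re z)\<^sup>2 + (Im z)\<^sup>2 < 1"
    using assms by (simp add: power_less_one_iff flip: cmod_power2)
  moreover have "(1 - Re z)\<^sup>2 + (Im z)\<^sup>2 > 0"
    using complex_Re_le_cmod[of z] assms by (intro add_pos_nonneg) auto
  ultimately show ?thesis
    by (simp add: Re_divide power2_eq_square field_simps)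
qed

lemma koebe_fun_starlike_of_order:
  assumes "\<beta> < 1"
  shows "koebe_fun \<beta> \<in> \<S>\<^sup>* \<beta>"
proof -
  let ?p = "\<lambda>z::complex. 1 + of_real (2 * (1 - \<beta>)) * z / (1 - z)"
  have "koebe_fun \<beta> holomorphic_on \<D>"
    using has_field_derivative_koebe_fun
    by (meson field_differentiable_at_within field_differentiable_def holomorphic_onI)
  moreover have "deriv (koebe_fun \<beta>) 0 = 1"
    using DERIV_imp_deriv[OF has_field_derivative_koebe_fun[of 0 \<beta>]] by simp
  moreover have "koebe_fun \<beta> 0 = 0" by (simp add: koebe_fun_def)
  moreover have "?p holomorphic_on \<D>"
    by (intro holomorphic_intros) auto
  then have "starlike_quotient (koebe_fun \<beta>) holomorphic_on \<D>"
    by (rule holomorphic_transform) (simp add: starlike_quotient_koebe_fun)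
  moreover have "Re (starlike_quotient (koebe_fun \<beta>) z) > \<beta>" if "z \<in> \<D>" for z
  proof -
    have "Re (?p z) = 1 + 2 * (1 - \<beta>) * Re (z / (1 - z))"
      using scaleR_complex.sel(1)[of "2 * (1 - \<beta>)" "z / (1 - z)"]
      by (simp only: scaleR_conv_of_real times_divide_eq_right plus_complex.sel one_complex.sel)
    \<comment> \<open>The constants fit exactly: 1 + 2(1 - \<beta>)(-1/2) = \<beta>.\<close>
    moreover have "2 * (1 - \<beta>) * Re (z / (1 - z)) > 2 * (1 - \<beta>) * (- 1 / 2)"
      using Re_div_one_minus_gt[of z] that assms by (intro mult_strict_left_mono) auto
    ultimately show ?thesis 
      unfolding starlike_quotient_koebe_fun[OF that] by argo
  qed
  ultimately show ?thesis
    by (simp add: starlike_of_order_def normalized_analytic_def analytic_on_open)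
qed

lemma booth_radius_fun_koebe_fun_le:
  assumes "\<beta> < 1"
  shows "booth_radius_fun 0 (koebe_fun \<beta>) \<le> 1 / (3 - 2 * \<beta>)"
  unfolding booth_radius_fun_def
proof (rule cSup_least)
  let ?S = "{r. 0 < r \<and> r < 1 \<and> starlike_quotient (koebe_fun \<beta>) analytic_on cball 0 r \<and>
     (\<forall>z. norm z \<le> r \<longrightarrow> starlike_quotient (koebe_fun \<beta>) z \<in> booth_fun 0 ` \<D>)}"
  show "r \<le> 1 / (3 - 2 * \<beta>)" if "r \<in> ?S" for r
  proof -
    have r: "0 < r" "r < 1" using that by auto
    \<comment> \<open>On the positive real axis the quotient minus 1 is real and positive, so
      testing the point z = r alone forces the bound.\<close>
    have "starlike_quotient (koebe_fun \<beta>) (of_real r) \<in> ball 1 1"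
      using that by (simp add: booth_fun_0_image)
    then have "norm (complex_of_real (2 * (1 - \<beta>) * r / (1 - r))) < 1"
      using r by (simp add: starlike_quotient_koebe_fun dist_norm)
    then have "2 * (1 - \<beta>) * r / (1 - r) < 1"
      unfolding norm_of_real by linarith
    then show ?thesis using r assms by (simp add: field_simps)
  qed
  \<comment> \<open>An upper bound passes to the real supremum only if the set is nonempty.\<close>
  have "0 < 1 / (3 - 2 * \<beta>)" using \<open>\<beta> < 1\<close> by simp
  then obtain r where "0 < r" "r < 1 / (3 - 2 * \<beta>)" using dense by blast
  then show "?S \<noteq> {}"
    using starlike_quotient_in_booth_image[OF assms koebe_fun_starlike_of_order[OF assms]] by blast
qed

theorem theorem3p2:
  fixes \<beta> :: real
  assumes "0 \<le> \<beta>" and "\<beta> < 1"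
  shows "booth_radius 0 (\<S>\<^sup>* \<beta>) = 1 / (3 - 2 * \<beta>)"
proof (rule antisym)
  \<comment> \<open>The lower estimate for every member of the class also supplies the bound below
    that the real infimum requires.\<close>
  have "booth_radius 0 (\<S>\<^sup>* \<beta>) \<le> booth_radius_fun 0 (koebe_fun \<beta>)"
    unfolding booth_radius_def
    using starlike_booth_radius_fun_ge[OF \<open>\<beta> < 1\<close>] koebe_fun_starlike_of_order[OF \<open>\<beta> < 1\<close>]
    by (intro cINF_lower bdd_belowI2)
  also have "\<dots> \<le> 1 / (3 - 2 * \<beta>)"
    using booth_radius_fun_koebe_fun_le[OF \<open>\<beta> < 1\<close>] .
  finally show "booth_radius 0 (\<S>\<^sup>* \<beta>) \<le> 1 / (3 - 2 * \<beta>)" .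
  show "1 / (3 - 2 * \<beta>) \<le> booth_radius 0 (\<S>\<^sup>* \<beta>)"
    unfolding booth_radius_def
    using starlike_booth_radius_fun_ge[OF \<open>\<beta> < 1\<close>] koebe_fun_starlike_of_order[OF \<open>\<beta> < 1\<close>]
    by (intro cINF_greatest) auto
qed

end
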